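(* Let $V\in\Gamma(\mathbb{R}^m)$ and $(\overline{x},\overline{\sigma})\in\mathbb{R}^n\times\operatorname{dom}V^*$. (i) Assume that $\nabla_x\Xi(\overline{x},\overline{\sigma})=0$ and $q(\overline{x})\in\partial V^*(\overline{\sigma})$. Then $(\overline{x},\overline{\sigma})\in\operatorname{dom}f\times S_{\mathrm{col}}$, $\overline{\sigma}\in\partial V(q(\overline{x}))$, and $$f(\overline{x})=\Xi(\overline{x},\overline{\sigma})=D(\overline{\sigma}).$$ (ii) Assume, in addition to the hypotheses of (i), that $A(\overline{\sigma})\succeq0$. Then $\overline{\sigma}\in S_{\mathrm{col}}^+$ and $$f(\overline{x})=\inf_{x\in\operatorname{dom}f}f(x)=\Xi(\overline{x},\overline{\sigma})=\sup_{\sigma\in S_{\mathrm{col}}^+}D(\sigma)=D(\overline{\sigma});$$ furthermore, if $\overline{\sigma}\in S^+$, then $\overline{x}$ is the unique global solution of the problem of minimizing $f(x)$ over $x\in\mathbb{R}^n$.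
   Context: $\Gamma(\mathbb{R}^m)$ is the class of proper convex lower semicontinuous functions $g:\mathbb{R}^m\to\overline{\mathbb{R}}=\mathbb{R}\cup\{-\infty,+\infty\}$; $\operatorname{dom}g=\{y: g(y)<\infty\}$; $g^*(\sigma)=\sup_{y}\{\langle y,\sigma\rangle-g(y)\}$ is the Fenchel conjugate; $\partial g$ is the convex subdifferential (empty outside $\operatorname{dom} g$). For $i\in\{0,\dots,m\}$ let $q_i(x)=\tfrac12\langle x,A_ix\rangle-\langle b_i,x\rangle+c_i$ on $\mathbb{R}^n$, with $A_i$ a real symmetric $n\times n$ matrix, $b_i\in\mathbb{R}^n$, $c_i\in\mathbb{R}$, and $q(x)=(q_1(x),\dots,q_m(x))^T$. Let $f:=q_0+V\circ q:\mathbb{R}^n\to\overline{\mathbb{R}}$, $\operatorname{dom}f=\{x: f(x)<\infty\}$. For $\sigma\in\mathbb{R}^m$ put, with $\sigma_0:=1$, $A(\sigma)=\sum_{k=0}^m\sigma_kA_k$, $b(\sigma)=\sum_{k=0}^m\sigma_kb_k$, $c(\sigma)=\sum_{k=0}^m\sigma_kc_k$, and let $$\Xi(x,\sigma)=q_0(x)+\langle q(x),\sigma\rangle-V^*(\sigma)=\tfrac12\langle x,A(\sigma)x\rangle-\langle b(\sigma),x\rangle+c(\sigma)-V^*(\sigma).$$ Sets: $S_{\mathrm{col}}=\{\sigma\in\operatorname{dom}V^*: b(\sigma)\in\operatorname{Im}A(\sigma)\}$; $S_{\mathrm{col}}^+=\{\sigma\in S_{\mathrm{col}}:A(\sigma)\succeq0\}$;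 $S^+=\{\sigma\in\operatorname{dom}V^*:A(\sigma)\succ0\}$. The dual function is $D:S_{\mathrm{col}}\to\mathbb{R}$, $D(\sigma):=\Xi(x,\sigma)$ for any $x$ with $A(\sigma)x=b(\sigma)$ (the value does not depend on the choice of such $x$). *)

theory Defs
  imports "HOL-Analysis.Analysis"
begin

definition edom :: "('a \<Rightarrow> ereal) \<Rightarrow> 'a set"
  where "edom g = {y. g y < \<infinity>}"

definition proper_fun :: "('a \<Rightarrow> ereal) \<Rightarrow> bool"
  where "proper_fun g \<longleftrightarrow> edom g \<noteq> {} \<and> (\<forall>y. g y \<noteq> -\<infinity>)"

text \<open>The library's \<^const>\<open>epigraph\<close> is only for real-valued functions.\<close>

definition econvex :: "('a::real_vector \<Rightarrow> ereal) \<Rightarrow> bool"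
  where "econvex g \<longleftrightarrow> convex {(y, t). g y \<le> ereal t}"

definition lsc :: "('a::topological_space \<Rightarrow> ereal) \<Rightarrow> bool"
  where "lsc g \<longleftrightarrow> (\<forall>y. g y \<le> Liminf (at y) g)"

definition Gamma_cvx :: "('a::euclidean_space \<Rightarrow> ereal) set"
  where "Gamma_cvx = {g. proper_fun g \<and> econvex g \<and> lsc g}"

definition fenchel_conj :: "('a::real_inner \<Rightarrow> ereal) \<Rightarrow> 'a \<Rightarrow> ereal"
  where "fenchel_conj g \<sigma> = (SUP y. ereal (y \<bullet> \<sigma>) - g y)"

definition subdiff :: "('a::real_inner \<Rightarrow> ereal) \<Rightarrow> 'a \<Rightarrow> 'a set"
  where "subdiff g y = {\<sigma>. y \<in> edom g \<and> (\<forall>z. g y + ereal ((z - y) \<bullet> \<sigma>) \<le> g z)}"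

definition psd :: "real^'n^'n \<Rightarrow> bool"
  where "psd M \<longleftrightarrow> (\<forall>x. 0 \<le> x \<bullet> (M *v x))"

definition pd :: "real^'n^'n \<Rightarrow> bool"
  where "pd M \<longleftrightarrow> (\<forall>x. x \<noteq> 0 \<longrightarrow> 0 < x \<bullet> (M *v x))"

text \<open>
  The index set \<open>{0, \<dots>, m}\<close> is the type \<^typ>\<open>'m option\<close>: \<^term>\<open>None\<close> is the index \<open>0\<close>, and
  \<^term>\<open>Some i\<close> for \<open>i :: 'm\<close> are the indices \<open>1, \<dots>, m\<close>.
\<close>

definition sigma_ext :: "real^'m \<Rightarrow> 'm option \<Rightarrow> real"
  where "sigma_ext \<sigma> k = (case k of None \<Rightarrow> 1 | Some i \<Rightarrow> \<sigma> $ i)"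

definition lincomb :: "('m::finite option \<Rightarrow> 'a::real_vector) \<Rightarrow> real^'m \<Rightarrow> 'a"
  where "lincomb F \<sigma> = (\<Sum>k\<in>UNIV. sigma_ext \<sigma> k *\<^sub>R F k)"

definition quad :: "real^'n^'n \<Rightarrow> real^'n \<Rightarrow> real \<Rightarrow> real^'n \<Rightarrow> real"
  where "quad M d e x = 1/2 * (x \<bullet> (M *v x)) - d \<bullet> x + e"

definition qvec ::
  "('m option \<Rightarrow> real^'n^'n) \<Rightarrow> ('m option \<Rightarrow> real^'n) \<Rightarrow> ('m option \<Rightarrow> real) \<Rightarrow> real^'n \<Rightarrow> real^'m"
  where "qvec A b c x = (\<chi> i. quad (A (Some i)) (b (Some i)) (c (Some i)) x)"

definition primal ::
  "(real^'m \<Rightarrow> ereal) \<Rightarrow> ('m option \<Rightarrow> real^'n^'n) \<Rightarrow> ('m option \<Rightarrow> real^'n) \<Rightarrow> ('m option \<Rightarrow> real)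
    \<Rightarrow> real^'n \<Rightarrow> ereal"
  where "primal V A b c x = ereal (quad (A None) (b None) (c None) x) + V (qvec A b c x)"

definition Xi ::
  "(real^'m \<Rightarrow> ereal) \<Rightarrow> ('m option \<Rightarrow> real^'n^'n) \<Rightarrow> ('m option \<Rightarrow> real^'n) \<Rightarrow> ('m option \<Rightarrow> real)
    \<Rightarrow> real^'n \<Rightarrow> real^'m \<Rightarrow> ereal"
  where "Xi V A b c x \<sigma> =
    ereal (quad (A None) (b None) (c None) x) + ereal (qvec A b c x \<bullet> \<sigma>) - fenchel_conj V \<sigma>"

definition S_col ::
  "(real^'m \<Rightarrow> ereal) \<Rightarrow> ('m option \<Rightarrow> real^'n^'n) \<Rightarrow> ('m option \<Rightarrow> real^'n) \<Rightarrow> (real^'m) set"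
  where "S_col V A b = {\<sigma> \<in> edom (fenchel_conj V). lincomb b \<sigma> \<in> range ((*v) (lincomb A \<sigma>))}"

definition S_col_plus ::
  "(real^'m \<Rightarrow> ereal) \<Rightarrow> ('m option \<Rightarrow> real^'n^'n) \<Rightarrow> ('m option \<Rightarrow> real^'n) \<Rightarrow> (real^'m) set"
  where "S_col_plus V A b = {\<sigma> \<in> S_col V A b. psd (lincomb A \<sigma>)}"

definition S_plus :: "(real^'m \<Rightarrow> ereal) \<Rightarrow> ('m option \<Rightarrow> real^'n^'n) \<Rightarrow> (real^'m) set"
  where "S_plus V A = {\<sigma> \<in> edom (fenchel_conj V). pd (lincomb A \<sigma>)}"

text \<open>
  Meaningful for \<open>\<sigma> \<in> S_col V A b\<close> only; by \<open>dual_fun_eq\<close> below the value does not depend on the choice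
  of \<open>x\<close>.
\<close>

definition dual_fun ::
  "(real^'m \<Rightarrow> ereal) \<Rightarrow> ('m option \<Rightarrow> real^'n^'n) \<Rightarrow> ('m option \<Rightarrow> real^'n) \<Rightarrow> ('m option \<Rightarrow> real)
    \<Rightarrow> real^'m \<Rightarrow> ereal"
  where "dual_fun V A b c \<sigma> = Xi V A b c (SOME x. lincomb A \<sigma> *v x = lincomb b \<sigma>) \<sigma>"

lemma lincomb_split: "lincomb F \<sigma> = F None + (\<Sum>i\<in>UNIV. (\<sigma> $ i) *\<^sub>R F (Some i))"
  by (simp add: lincomb_def UNIV_option_conv sum.reindex sigma_ext_def)

lemma Xi_eq: "Xi V A b c x \<sigma> =
    ereal (quad (lincomb A \<sigma>) (lincomb b \<sigma>) (lincomb c \<sigma>) x) - fenchel_conj V \<sigma>"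
proof -
  have "(\<Sum>i\<in>UNIV. (\<sigma> $ i) *\<^sub>R A (Some i)) *v x = (\<Sum>i\<in>UNIV. (\<sigma> $ i) *\<^sub>R (A (Some i) *v x))"
    using linear_sum[of "\<lambda>M. M *v x" "\<lambda>i. (\<sigma> $ i) *\<^sub>R A (Some i)" UNIV]
    by (simp add: linear_iff matrix_vector_mult_add_rdistrib scaleR_matrix_vector_assoc)
  then have "quad (A None) (b None) (c None) x + qvec A b c x \<bullet> \<sigma> =
    quad (lincomb A \<sigma>) (lincomb b \<sigma>) (lincomb c \<sigma>) x"
    by (simp add: lincomb_split quad_def qvec_def inner_vec_def[of "vec_lambda _"]
        matrix_vector_mult_add_rdistrib
        inner_add inner_sum_left inner_sum_right algebra_simps sum.distrib sum_subtractf sum_distrib_left)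
  then show ?thesis by (simp add: Xi_def)
qed

lemma dual_fun_eq:
  assumes sym: "\<And>k. transpose (A k) = A k" and x: "lincomb A \<sigma> *v x = lincomb b \<sigma>"
  shows "dual_fun V A b c \<sigma> = Xi V A b c x \<sigma>"
proof -
  define M where "M = lincomb A \<sigma>"
  define y where "y = (SOME x. M *v x = lincomb b \<sigma>)"
  have y: "M *v y = lincomb b \<sigma>"
    unfolding y_def M_def by (rule someI[of _ x]) (rule x)
  have M: "transpose M = M"
    using sym by (simp add: M_def lincomb_def transpose_def vec_eq_iff)
  have "(M *v x) \<bullet> y = x \<bullet> (M *v y)"
    using dot_lmul_matrix[of x M y] M by (metis transpose_matrix_vector)
  then have "lincomb b \<sigma> \<bullet> x = lincomb b \<sigma> \<bullet> y"
    using x y by (simp add: M_def inner_commute)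
  then have "quad M (lincomb b \<sigma>) e y = quad M (lincomb b \<sigma>) e x" for e
    using x y by (simp add: quad_def M_def inner_commute)
  then show ?thesis
    by (simp add: dual_fun_def Xi_eq M_def y_def)
qed

end

theory Submission
  imports Defs
begin

text \<open>
  The hypothesis \<open>q(xbar) \<in> \<partial>V\<^sup>*(sbar)\<close> says that \<open>\<langle>q(xbar), \<cdot>\<rangle> - V\<^sup>*\<close> is maximal at \<open>sbar\<close>. Separating
  the closed convex epigraph of \<open>V\<close> from the point with that maximal height above \<open>q(xbar)\<close> yields equality in the
  Fenchel-Young inequality, \<open>V(q(xbar)) + V\<^sup>*(sbar) = \<langle>q(xbar), sbar\<rangle>\<close>, that is \<open>f(xbar) = \<Xi>(xbar, sbar)\<close>.
  In general \<open>\<Xi>(x, sbar) \<le> f(x)\<close>, and for \<open>A(sbar) \<succeq> 0\<close> a critical point of the quadratic function \<open>\<Xi>(\<cdot>, sbar)\<close>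
  is a global minimizer. Hence \<open>D(\<sigma>) \<le> \<Xi>(xbar, \<sigma>) \<le> f(xbar) = \<Xi>(xbar, sbar) \<le> \<Xi>(x, sbar) \<le> f(x)\<close> for all
  \<open>x\<close> and all \<open>\<sigma> \<in> S\<^sub>c\<^sub>o\<^sub>l\<^sup>+\<close>.
\<close>

section \<open>Fenchel conjugates\<close>

lemma fenchel_young: "ereal (y \<bullet> \<sigma>) - g y \<le> fenchel_conj g \<sigma>"
  unfolding fenchel_conj_def by (rule SUP_upper) simp

lemma fenchel_conj_not_minf:
  assumes "proper_fun g"
  shows "fenchel_conj g \<sigma> \<noteq> -\<infinity>"
proof -
  obtain y where "g y < \<infinity>" "g y \<noteq> -\<infinity>"
    using assms by (auto simp: proper_fun_def edom_def)
  then show ?thesis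
    using fenchel_young[of y \<sigma> g] by (cases "g y") auto
qed

lemma fenchel_conj_real:
  assumes "proper_fun g" "\<sigma> \<in> edom (fenchel_conj g)"
  obtains v where "fenchel_conj g \<sigma> = ereal v"
  using assms fenchel_conj_not_minf[of g \<sigma>] by (cases "fenchel_conj g \<sigma>") (auto simp: edom_def)

text \<open>Real heights \<open>t\<close> over \<open>y\<close> stand in for \<open>g y\<close>, so
  conjugates can be bounded from inequalities on the epigraph in real arithmetic. Where
  \<open>g y\<close> is infinite the term in the supremum is -\<infinity>.\<close>

lemma fenchel_conj_le:
  assumes "proper_fun g" "\<And>y t. g y \<le> ereal t \<Longrightarrow> y \<bullet> \<sigma> - t \<le> v"
  shows "fenchel_conj g \<sigma> \<le> ereal v"
  unfolding fenchel_conj_def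
proof (rule SUP_least)
  fix y
  show "ereal (y \<bullet> \<sigma>) - g y \<le> ereal v"
    using assms(1) assms(2)[of y] by (cases "g y") (auto simp: proper_fun_def)
qed

text \<open>If \<open>t < r < g y\<close>, lower semicontinuity keeps \<open>g\<close> above
  \<open>r\<close> on a neighbourhood \<open>U\<close> of \<open>y\<close>, so the open box
  \<open>U \<times> {..<r}\<close> around \<open>(y, t)\<close> misses the epigraph.\<close>

lemma closed_epigraph:
  fixes g :: "'a::topological_space \<Rightarrow> ereal"
  assumes "lsc g"
  shows "closed {(y, t). g y \<le> ereal t}"
  unfolding closed_def
proof (rule Topological_Spaces.openI)
  fix p assume "p \<in> - {(y, t). g y \<le> ereal t}"
  then obtain y t where p: "p = (y, t)" and "ereal t < g y"
    by (cases p) auto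
  then obtain r where r: "ereal t < ereal r" "ereal r < g y"
    using ereal_dense2 by blast
  then have "ereal r < Liminf (at y) g"
    using assms by (auto simp: lsc_def intro: less_le_trans)
  then obtain U where U: "open U" "y \<in> U" "\<And>z. z \<in> U \<Longrightarrow> z \<noteq> y \<Longrightarrow> ereal r < g z"
    by (auto dest!: less_LiminfD simp: eventually_at_topological)
  have "U \<times> {..<r} \<subseteq> - {(y, t). g y \<le> ereal t}"
  proof clarify
    fix z s assume z: "z \<in> U" "s < r" and "g z \<le> ereal s"
    \<comment> \<open>\<open>Liminf (at y) g\<close> ignores the value at \<open>y\<close> itself;
      for \<open>z = y\<close> the bound is the choice of \<open>r\<close>.\<close>
    have "ereal r < g z"
      using U(3)[of z] z r by (cases "z = y") auto
    also have "\<dots> \<le> ereal s" by fact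
    finally show False using z by simp
  qed
  moreover have "p \<in> U \<times> {..<r}" "open (U \<times> {..<r})"
    using U r p by (auto intro: open_Times)
  ultimately show "\<exists>T. open T \<and> p \<in> T \<and> T \<subseteq> - {(y, t). g y \<le> ereal t}"
    by blast
qed

text \<open>By the subgradient condition the biconjugate of \<open>g\<close> at \<open>y\<close> is
  \<open>y \<bullet> \<sigma> - v\<close>, so this is the hard half of Fenchel-Moreau at
  \<open>y\<close>. A separating hyperplane would produce a point where the conjugate is too small
  for the subgradient inequality at \<open>\<sigma>\<close>.\<close>

lemma Gamma_cvx_subdiff_conj_le:
  fixes g :: "'a::euclidean_space \<Rightarrow> ereal"
  assumes g: "g \<in> Gamma_cvx" and y: "y \<in> subdiff (fenchel_conj g) \<sigma>"
    and v: "fenchel_conj g \<sigma> = ereal v"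
  shows "g y \<le> ereal (y \<bullet> \<sigma> - v)"
proof (rule ccontr)
  assume contra: "\<not> g y \<le> ereal (y \<bullet> \<sigma> - v)"
  let ?E = "{(y, t). g y \<le> ereal t}"
  have proper: "proper_fun g" and E: "convex ?E" "closed ?E"
    using g closed_epigraph by (auto simp: Gamma_cvx_def econvex_def)
  have sub: "v + (z - \<sigma>) \<bullet> y \<le> w" if "fenchel_conj g z \<le> ereal w" for z w
    using order_trans[OF _ that] y v by (force simp: subdiff_def)
  obtain y0 t0 where y0: "g y0 = ereal t0"
    using proper unfolding proper_fun_def edom_def
    by (metis (mono_tags) empty_Collect_eq ereal_infty_less(1) real_of_ereal.elims)
  obtain a \<beta> where ab: "a \<bullet> (y, y \<bullet> \<sigma> - v) < \<beta>" "\<And>p. p \<in> ?E \<Longrightarrow> \<beta> < a \<bullet> p"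
    using separating_hyperplane_closed_point[OF E, of "(y, y \<bullet> \<sigma> - v)"] contra by auto
  obtain u r where a: "a = (u, r)" by (cases a)
  have below: "u \<bullet> y + r * (y \<bullet> \<sigma> - v) < \<beta>"
    using ab(1) by (simp add: a)
  have above: "\<beta> < u \<bullet> z + r * t" if "g z \<le> ereal t" for z t
    using ab(2)[of "(z, t)"] that by (simp add: a)
  \<comment> \<open>The epigraph contains an upward ray over \<open>y0\<close>; with
    \<open>r < 0\<close> the functional would drop to \<open>\<beta>\<close> or below along
    it.\<close>
  have "r \<ge> 0"
  proof (rule ccontr)
    assume r: "\<not> r \<ge> 0"
    define t where "t = max t0 ((\<beta> - u \<bullet> y0) / r)"
    have "(\<beta> - u \<bullet> y0) / r \<le> t" by (simp add: t_def)
    then have "u \<bullet> y0 + r * t \<le> \<beta>"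
      using r by (simp add: field_simps)
    moreover have "g y0 \<le> ereal t" by (simp add: y0 t_def)
    ultimately show False using above by fastforce
  qed
  show False
  proof (cases "r = 0")
    case True
    \<comment> \<open>The hyperplane is vertical: moving from \<open>\<sigma>\<close> along \<open>- u\<close> violates the subgradient inequality at \<open>\<sigma>\<close>.\<close>
    have "fenchel_conj g (\<sigma> - u) \<le> ereal (v - \<beta>)"
    proof (rule fenchel_conj_le[OF proper])
      fix z t assume z: "g z \<le> ereal t"
      have "ereal (z \<bullet> \<sigma>) - g z \<le> ereal v"
        using fenchel_young[of z \<sigma> g] v by simp
      then have "z \<bullet> \<sigma> - t \<le> v"
        using z by (cases "g z") auto
      then show "z \<bullet> (\<sigma> - u) - t \<le> v - \<beta>"
        using above[OF z] True by (simp add: inner_diff_right inner_commute)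
    qed
    from sub[OF this] show False
      using below True by simp
  next
    case False
    with \<open>r \<ge> 0\<close> have r: "r > 0" by simp
    \<comment> \<open>Divided by \<open>r\<close>, the hyperplane is the graph of an affine minorant
      of \<open>g\<close> with slope \<open>- (u /\<^sub>R r)\<close>. This bounds the conjugate at
      that slope, while the minorant at \<open>y\<close> exceeds
      \<open>y \<bullet> \<sigma> - v\<close>.\<close>
    have "fenchel_conj g (- (u /\<^sub>R r)) \<le> ereal (- (\<beta> / r))"
    proof (rule fenchel_conj_le[OF proper])
      fix z t assume "g z \<le> ereal t"
      from above[OF this] have "\<beta> / r \<le> u \<bullet> z / r + t"
        using r by (simp add: field_simps)
      then show "z \<bullet> (- (u /\<^sub>R r)) - t \<le> - (\<beta> / r)"
        by (simp add: divide_inverse inner_commute mult.commute)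
    qed
    from sub[OF this] have "v - u \<bullet> y / r - y \<bullet> \<sigma> \<le> - (\<beta> / r)"
      by (simp add: inner_diff_left inner_diff_right divide_inverse inner_commute mult.commute)
    moreover have "u \<bullet> y / r + (y \<bullet> \<sigma> - v) < \<beta> / r"
      using divide_strict_right_mono[OF below r] r by (simp add: add_divide_distrib)
    ultimately show False by simp
  qed
qed

section \<open>Quadratic functions\<close>

lemma transpose_lincomb:
  fixes A :: "'m::finite option \<Rightarrow> real^'n^'n"
  assumes "\<And>k. transpose (A k) = A k"
  shows "transpose (lincomb A \<sigma>) = lincomb A \<sigma>"
  using assms by (simp add: lincomb_def transpose_def vec_eq_iff)

lemma inner_symmetric_matrix:
  fixes M :: "real^'n^'n"
  assumes "transpose M = M"
  shows "x \<bullet> (M *v y) = (M *v x) \<bullet> y"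
  using dot_lmul_matrix[of x M y] assms by (metis transpose_matrix_vector)

lemma GDERIV_quad:
  assumes "transpose M = M"
  shows "GDERIV (quad M d e) x :> (M *v x - d)"
proof -
  have "((*v) M has_derivative (*v) M) (at x)"
    by (rule bounded_linear_imp_has_derivative) simp
  then have "(quad M d e has_derivative (\<lambda>h. 1/2 * (x \<bullet> (M *v h) + h \<bullet> (M *v x)) - d \<bullet> h)) (at x)"
    unfolding quad_def[abs_def] by (auto intro!: derivative_eq_intros)
  then show ?thesis
    unfolding gderiv_def
    by (simp add: inner_symmetric_matrix[OF assms, of x] inner_diff_right inner_commute)
qed

text \<open>The second-order Taylor expansion of a quadratic function is exact, and its linear term
  vanishes at a critical point.\<close>

lemma quad_expand_critical:
  assumes sym: "transpose M = M" and x: "M *v x = d"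
  shows "quad M d e y = quad M d e x + 1/2 * ((y - x) \<bullet> (M *v (y - x)))"
  using inner_symmetric_matrix[OF sym, of x y] x
  by (simp add: quad_def matrix_vector_mult_diff_distrib inner_diff_left inner_diff_right
      inner_commute algebra_simps)

section \<open>Duality\<close>

text \<open>Fenchel-Young at \<open>qvec A b c x\<close>, rearranged using that the conjugate is
  finite at \<open>\<sigma>\<close>.\<close>

lemma Xi_le_primal:
  assumes "proper_fun V" "\<sigma> \<in> edom (fenchel_conj V)"
  shows "Xi V A b c x \<sigma> \<le> primal V A b c x"
proof -
  obtain v where "fenchel_conj V \<sigma> = ereal v"
    using fenchel_conj_real[OF assms] .
  moreover have "V (qvec A b c x) \<noteq> -\<infinity>"
    using assms by (simp add: proper_fun_def)
  ultimately show ?thesis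
    using fenchel_young[of "qvec A b c x" \<sigma> V]
    by (cases "V (qvec A b c x)") (auto simp: Xi_def primal_def)
qed

lemma Xi_critical_point:
  fixes A :: "'m::finite option \<Rightarrow> real^'n^'n"
  assumes sym: "\<And>k. transpose (A k) = A k" and v: "fenchel_conj V \<sigma> = ereal v"
    and grad: "GDERIV (\<lambda>x. real_of_ereal (Xi V A b c x \<sigma>)) x :> 0"
  shows "lincomb A \<sigma> *v x = lincomb b \<sigma>"
proof -
  let ?g = "lincomb A \<sigma> *v x - lincomb b \<sigma>"
  \<comment> \<open>As the conjugate has the real value \<open>v\<close>,
    \<open>real_of_ereal\<close> loses nothing and \<open>v\<close> is absorbed into the constant
    term.\<close>
  have "(\<lambda>x. real_of_ereal (Xi V A b c x \<sigma>)) = quad (lincomb A \<sigma>) (lincomb b \<sigma>) (lincomb c \<sigma> - v)"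
    by (rule ext) (simp add: Xi_eq v quad_def)
  then have "(\<lambda>h. h \<bullet> ?g) = (\<lambda>h. h \<bullet> 0)"
    using has_derivative_unique grad GDERIV_quad[OF transpose_lincomb[of A, OF sym]]
    unfolding gderiv_def by metis
  \<comment> \<open>The two derivatives agree as functions of the direction; the direction
    \<open>?g\<close> itself shows that \<open>?g\<close> is zero.\<close>
  then have "?g \<bullet> ?g = ?g \<bullet> 0" by (rule fun_cong)
  then show ?thesis by simp
qed

lemma Xi_minimal_at_critical_point:
  fixes A :: "'m::finite option \<Rightarrow> real^'n^'n"
  assumes sym: "\<And>k. transpose (A k) = A k" and "psd (lincomb A \<sigma>)"
    and x: "lincomb A \<sigma> *v x = lincomb b \<sigma>"
  shows "Xi V A b c x \<sigma> \<le> Xi V A b c y \<sigma>"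
proof -
  have "quad (lincomb A \<sigma>) (lincomb b \<sigma>) (lincomb c \<sigma>) x \<le> quad (lincomb A \<sigma>) (lincomb b \<sigma>) (lincomb c \<sigma>) y"
    using assms(2) unfolding psd_def quad_expand_critical[OF transpose_lincomb[of A, OF sym] x, of _ y]
    by simp
  then show ?thesis
    by (simp add: Xi_eq ereal_minus_mono)
qed

text \<open>Strictness survives the subtraction because the conjugate has the real value
  \<open>v\<close>.\<close>

lemma Xi_strictly_minimal_at_critical_point:
  fixes A :: "'m::finite option \<Rightarrow> real^'n^'n"
  assumes sym: "\<And>k. transpose (A k) = A k" and "pd (lincomb A \<sigma>)"
    and x: "lincomb A \<sigma> *v x = lincomb b \<sigma>"
    and v: "fenchel_conj V \<sigma> = ereal v" and "y \<noteq> x"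
  shows "Xi V A b c x \<sigma> < Xi V A b c y \<sigma>"
  using assms(2,5) unfolding pd_def Xi_eq v quad_expand_critical[OF transpose_lincomb[of A, OF sym] x, of _ y]
  by simp

theorem proposition2:
  fixes V :: "real^'m \<Rightarrow> ereal"
    and A :: "'m option \<Rightarrow> real^'n^'n" and b :: "'m option \<Rightarrow> real^'n" and c :: "'m option \<Rightarrow> real"
    and xbar :: "real^'n" and sbar :: "real^'m"
  assumes V: "V \<in> Gamma_cvx"
    and sym: "\<And>k. transpose (A k) = A k"
    and sbar: "sbar \<in> edom (fenchel_conj V)"
  shows "(GDERIV (\<lambda>x. real_of_ereal (Xi V A b c x sbar)) xbar :> 0
            \<and> qvec A b c xbar \<in> subdiff (fenchel_conj V) sbar \<longrightarrow>
          (xbar, sbar) \<in> edom (primal V A b c) \<times> S_col V A b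
            \<and> sbar \<in> subdiff V (qvec A b c xbar)
            \<and> primal V A b c xbar = Xi V A b c xbar sbar
            \<and> Xi V A b c xbar sbar = dual_fun V A b c sbar)
       \<and> (GDERIV (\<lambda>x. real_of_ereal (Xi V A b c x sbar)) xbar :> 0
            \<and> qvec A b c xbar \<in> subdiff (fenchel_conj V) sbar
            \<and> psd (lincomb A sbar) \<longrightarrow>
          sbar \<in> S_col_plus V A b
            \<and> primal V A b c xbar = (INF x\<in>edom (primal V A b c). primal V A b c x)
            \<and> (INF x\<in>edom (primal V A b c). primal V A b c x) = Xi V A b c xbar sbar
            \<and> Xi V A b c xbar sbar = (SUP \<sigma>\<in>S_col_plus V A b. dual_fun V A b c \<sigma>)
            \<and> (SUP \<sigma>\<in>S_col_plus V A b. dual_fun V A b c \<sigma>) = dual_fun V A b c sbar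
            \<and> (sbar \<in> S_plus V A \<longrightarrow>
                is_arg_min (primal V A b c) (\<lambda>_. True) xbar
                \<and> (\<forall>x. is_arg_min (primal V A b c) (\<lambda>_. True) x \<longrightarrow> x = xbar)))"
proof -
  let ?f = "primal V A b c" and ?q = "qvec A b c xbar"
  have proper: "proper_fun V" using V by (simp add: Gamma_cvx_def)
  obtain v where v: "fenchel_conj V sbar = ereal v"
    using fenchel_conj_real[OF proper sbar] .
  have i: "(xbar, sbar) \<in> edom ?f \<times> S_col V A b \<and> sbar \<in> subdiff V ?q
      \<and> ?f xbar = Xi V A b c xbar sbar \<and> Xi V A b c xbar sbar = dual_fun V A b c sbar"
    and crit: "lincomb A sbar *v xbar = lincomb b sbar"
    if grad: "GDERIV (\<lambda>x. real_of_ereal (Xi V A b c x sbar)) xbar :> 0"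
      and q: "?q \<in> subdiff (fenchel_conj V) sbar"
  proof -
    show crit: "lincomb A sbar *v xbar = lincomb b sbar"
      using Xi_critical_point[OF sym v grad] .
    then have col: "sbar \<in> S_col V A b"
      using sbar unfolding S_col_def by (metis (mono_tags, lifting) mem_Collect_eq rangeI)
    \<comment> \<open>Used twice: at \<open>?q\<close> it is the lower bound for
      \<open>V ?q\<close>, and for general \<open>z\<close> it becomes the subgradient inequality
      once \<open>V ?q\<close> is known.\<close>
    have young: "ereal (z \<bullet> sbar - v) \<le> V z" for z
      using fenchel_young[of z sbar V] v by (cases "V z") auto
    have Vq: "V ?q = ereal (?q \<bullet> sbar - v)"
      using Gamma_cvx_subdiff_conj_le[OF V q v] young by (rule antisym)
    then have "sbar \<in> subdiff V ?q"
      using young by (simp add: subdiff_def edom_def inner_diff_left)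
    moreover have "?f xbar = Xi V A b c xbar sbar"
      by (simp add: primal_def Xi_def Vq v)
    moreover have "xbar \<in> edom ?f"
      by (simp add: primal_def edom_def Vq)
    ultimately show "(xbar, sbar) \<in> edom ?f \<times> S_col V A b \<and> sbar \<in> subdiff V ?q
      \<and> ?f xbar = Xi V A b c xbar sbar \<and> Xi V A b c xbar sbar = dual_fun V A b c sbar"
      using col dual_fun_eq[of A, OF sym crit] by simp
  qed
  have ii: "sbar \<in> S_col_plus V A b
      \<and> ?f xbar = (INF x\<in>edom ?f. ?f x)
      \<and> (INF x\<in>edom ?f. ?f x) = Xi V A b c xbar sbar
      \<and> Xi V A b c xbar sbar = (SUP \<sigma>\<in>S_col_plus V A b. dual_fun V A b c \<sigma>)
      \<and> (SUP \<sigma>\<in>S_col_plus V A b. dual_fun V A b c \<sigma>) = dual_fun V A b c sbar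
      \<and> (sbar \<in> S_plus V A \<longrightarrow> is_arg_min ?f (\<lambda>_. True) xbar
          \<and> (\<forall>x. is_arg_min ?f (\<lambda>_. True) x \<longrightarrow> x = xbar))"
    if grad: "GDERIV (\<lambda>x. real_of_ereal (Xi V A b c x sbar)) xbar :> 0"
      and q: "?q \<in> subdiff (fenchel_conj V) sbar" and psd: "psd (lincomb A sbar)"
  proof -
    note i = i[OF grad q] and crit = crit[OF grad q]
    have col: "sbar \<in> S_col_plus V A b"
      using i psd by (simp add: S_col_plus_def)
    have min: "?f xbar \<le> ?f x" for x
      using i Xi_minimal_at_critical_point[of A, OF sym psd crit, of V c x]
        Xi_le_primal[OF proper sbar, of A b c x] by simp
    \<comment> \<open>The infimum over the domain is attained because part (i) places
      \<open>xbar\<close> in it.\<close>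
    have INF: "(INF x\<in>edom ?f. ?f x) = ?f xbar"
      using i min by (intro antisym INF_lower INF_greatest) auto
    have "dual_fun V A b c \<sigma> \<le> dual_fun V A b c sbar" if plus: "\<sigma> \<in> S_col_plus V A b" for \<sigma>
    proof -
      have \<sigma>: "psd (lincomb A \<sigma>)" "\<sigma> \<in> edom (fenchel_conj V)"
        and "lincomb b \<sigma> \<in> range ((*v) (lincomb A \<sigma>))"
        using plus by (simp_all add: S_col_plus_def S_col_def)
      then obtain x where x: "lincomb A \<sigma> *v x = lincomb b \<sigma>"
        by (metis rangeE)
      have "dual_fun V A b c \<sigma> = Xi V A b c x \<sigma>"
        by (rule dual_fun_eq[of A, OF sym x])
      also have "\<dots> \<le> Xi V A b c xbar \<sigma>"
        by (rule Xi_minimal_at_critical_point[of A, OF sym \<sigma>(1) x])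
      also have "\<dots> \<le> ?f xbar"
        by (rule Xi_le_primal[OF proper \<sigma>(2)])
      finally show ?thesis using i by simp
    qed
    then have SUP: "(SUP \<sigma>\<in>S_col_plus V A b. dual_fun V A b c \<sigma>) = dual_fun V A b c sbar"
      using col by (intro antisym SUP_upper SUP_least) auto
    \<comment> \<open>Positive definiteness makes the bound by \<open>Xi\<close> strict away from
      \<open>xbar\<close>, so no other point can minimize \<open>?f\<close>.\<close>
    have uniq: "x = xbar" if "sbar \<in> S_plus V A" "is_arg_min ?f (\<lambda>_. True) x" for x
    proof (rule ccontr)
      assume "x \<noteq> xbar"
      then have "Xi V A b c xbar sbar < Xi V A b c x sbar"
        using that(1) by (intro Xi_strictly_minimal_at_critical_point[of A, OF sym _ crit v])
          (auto simp: S_plus_def)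
      also have "\<dots> \<le> ?f x" by (rule Xi_le_primal[OF proper sbar])
      finally have "?f xbar < ?f x" using i by simp
      then show False
        using that(2) unfolding is_arg_min_def by blast
    qed
    have argmin: "is_arg_min ?f (\<lambda>_. True) xbar"
      using min by (simp add: is_arg_min_def not_less)
    have "?f xbar = (INF x\<in>edom ?f. ?f x)" "(INF x\<in>edom ?f. ?f x) = Xi V A b c xbar sbar"
      "Xi V A b c xbar sbar = (SUP \<sigma>\<in>S_col_plus V A b. dual_fun V A b c \<sigma>)"
      using INF SUP i by simp_all
    with col SUP uniq argmin show ?thesis by blast
  qed
  show ?thesis using i ii by blast
qed

end
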